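(* For $x,y\in\{0,1\}$ let $P(a',b'|x,y)$, $a',b'\in\{0,1\}$, be the quantum distribution obtained by measuring the singlet state $|\psi^-\rangle=\frac1{\sqrt2}(|01\rangle-|10\rangle)$ with Alice's observable $\sigma_z$ (if $x=0$) or $\sigma_x$ (if $x=1$) on the first qubit and Bob's observable $\frac{-\sigma_z-\sigma_x}{\sqrt2}$ (if $y=0$) or $\frac{-\sigma_z+\sigma_x}{\sqrt2}$ (if $y=1$) on the second qubit. Let $x,y$ be independent uniformly random bits and, given $(x,y)$, let $(a',b')$ be distributed according to $P(a',b'|x,y)$. Define the outputs $a,b\in\{0,1,2\}$ and $c\in\{0,1\}$ as follows: - $a=0$ if $a'=0$; $a=1$ if $x=0$ and $a'=1$; $a=2$ if $x=1$ and $a'=1$; - $b=0$ if $y=0$ and $b'=0$; $b=1$ if $y=1$ and $b'=0$; $b=2$ if $b'=1$; - $c=xy$. Then the resulting distribution $P(a,b,c)$ (with output cardinalities $3$-$3$-$2$) is not triangle-local.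
   Context: Triangle-local: a distribution $P(a,b,c)$ is triangle-local if there are independent random variables $\alpha,\beta,\gamma$ (with arbitrary distributions $\mu,\eta,\nu$) and conditional distributions $P_A(a|\beta,\gamma)$, $P_B(b|\gamma,\alpha)$, $P_C(c|\alpha,\beta)$ such that $P(a,b,c)=\int d\mu(\alpha)\,d\eta(\beta)\,d\nu(\gamma)\,P_A(a|\beta,\gamma)P_B(b|\gamma,\alpha)P_C(c|\alpha,\beta)$. Convention: measuring an observable with eigenvalues $\pm1$, the outcome bit is $0$ for eigenvalue $+1$ and $1$ for eigenvalue $-1$. With this convention $P(a',b'|x,y)=\frac14\left(1+(-1)^{a'+b'+xy}\frac1{\sqrt2}\right)$. Here $\sigma_x,\sigma_z$ are the Pauli matrices. In the triangle network this distribution is realised with the $\gamma$ source distributing the singlet to Alice and Bob, the $\beta$ source distributing $x$ to Alice and Charlie, and the $\alpha$ source distributing $y$ to Bob and Charlie. *)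

theory Defs
  imports "HOL-Probability.Probability"
begin

section \<open>Triangle-local distributions\<close>

definition cond_distribution :: "'w measure \<Rightarrow> 'o set \<Rightarrow> ('o \<Rightarrow> 'w \<Rightarrow> real) \<Rightarrow> bool" where
  "cond_distribution M S Q \<longleftrightarrow>
     (\<forall>s\<in>S. Q s \<in> borel_measurable M) \<and>
     (\<forall>w\<in>space M. (\<forall>s\<in>S. 0 \<le> Q s w) \<and> (\<Sum>s\<in>S. Q s w) = 1)"

text \<open>HOL cannot quantify over types inside a formula. The sample spaces of the three sources
  have the types given by the type arguments; leaving these as type variables in a negative
  statement covers arbitrary sample spaces.\<close>

definition triangle_local ::
  "'x itself \<Rightarrow> 'y itself \<Rightarrow> 'z itself \<Rightarrow> 'a set \<Rightarrow> 'b set \<Rightarrow> 'c set \<Rightarrow>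
   ('a \<Rightarrow> 'b \<Rightarrow> 'c \<Rightarrow> real) \<Rightarrow> bool" where
  "triangle_local _ _ _ A B C P \<longleftrightarrow>
     (\<exists>(\<mu> :: 'x measure) (\<eta> :: 'y measure) (\<nu> :: 'z measure) PA PB PC.
        prob_space \<mu> \<and> prob_space \<eta> \<and> prob_space \<nu> \<and>
        cond_distribution (\<eta> \<Otimes>\<^sub>M \<nu>) A PA \<and>
        cond_distribution (\<nu> \<Otimes>\<^sub>M \<mu>) B PB \<and>
        cond_distribution (\<mu> \<Otimes>\<^sub>M \<eta>) C PC \<and>
        (\<forall>a\<in>A. \<forall>b\<in>B. \<forall>c\<in>C.
           P a b c =
             (\<integral>(\<alpha>, \<beta>, \<gamma>). PA a (\<beta>, \<gamma>) * PB b (\<gamma>, \<alpha>) * PC c (\<alpha>, \<beta>) \<partial>(\<mu> \<Otimes>\<^sub>M \<eta> \<Otimes>\<^sub>M \<nu>))))"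


section \<open>Two-qubit measurements\<close>

text \<open>The computational basis of a qubit is indexed by the elements 0 and 1 of type 2, that of a
  pair of qubits by pairs of such indices.\<close>

definition ket :: "2 \<Rightarrow> complex ^ 2" where
  "ket i = axis i 1"

definition tensor_vec :: "complex ^ 'm \<Rightarrow> complex ^ 'n \<Rightarrow> complex ^ ('m \<times> 'n)" where
  "tensor_vec u v = (\<chi> p. u $ fst p * v $ snd p)"

definition tensor_mat ::
  "complex ^ 'm ^ 'm \<Rightarrow> complex ^ 'n ^ 'n \<Rightarrow> complex ^ ('m \<times> 'n) ^ ('m \<times> 'n)" where
  "tensor_mat X Y = (\<chi> p q. X $ fst p $ fst q * Y $ snd p $ snd q)"

definition cinner :: "complex ^ 'n \<Rightarrow> complex ^ 'n \<Rightarrow> complex" where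
  "cinner u v = (\<Sum>i\<in>UNIV. cnj (u $ i) * v $ i)"

definition adjoint_mat :: "complex ^ 'n ^ 'n \<Rightarrow> complex ^ 'n ^ 'n" where
  "adjoint_mat X = (\<chi> i j. cnj (X $ j $ i))"

definition is_eigenprojector :: "complex ^ 'n ^ 'n \<Rightarrow> complex \<Rightarrow> complex ^ 'n ^ 'n \<Rightarrow> bool" where
  "is_eigenprojector X l E \<longleftrightarrow>
     adjoint_mat E = E \<and> E ** E = E \<and> range ((*v) E) = {v. X *v v = l *s v}"

definition eigenprojector :: "complex ^ 'n ^ 'n \<Rightarrow> complex \<Rightarrow> complex ^ 'n ^ 'n" where
  "eigenprojector X l = (THE E. is_eigenprojector X l E)"

text \<open>Born rule for local measurements of two observables with eigenvalues 1 and -1; outcome bit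
  \<open>r\<close> stands for the eigenvalue \<open>(- 1) ^ r\<close>.\<close>

definition born_prob ::
  "complex ^ ('m \<times> 'n) \<Rightarrow> complex ^ 'm ^ 'm \<Rightarrow> complex ^ 'n ^ 'n \<Rightarrow> nat \<Rightarrow> nat \<Rightarrow> real" where
  "born_prob \<psi> X Y r s =
     Re (cinner \<psi> (tensor_mat (eigenprojector X ((- 1) ^ r)) (eigenprojector Y ((- 1) ^ s)) *v \<psi>))"

definition sigma_x :: "complex ^ 2 ^ 2" where
  "sigma_x = (\<chi> i j. if i = j then 0 else 1)"

definition sigma_z :: "complex ^ 2 ^ 2" where
  "sigma_z = (\<chi> i j. if i = j then (if i = 0 then 1 else - 1) else 0)"

definition singlet :: "complex ^ (2 \<times> 2)" where
  "singlet = (1 / sqrt 2) *\<^sub>R (tensor_vec (ket 0) (ket 1) - tensor_vec (ket 1) (ket 0))"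

definition alice_obs :: "nat \<Rightarrow> complex ^ 2 ^ 2" where
  "alice_obs x = (if x = 0 then sigma_z else sigma_x)"

definition bob_obs :: "nat \<Rightarrow> complex ^ 2 ^ 2" where
  "bob_obs y = (1 / sqrt 2) *\<^sub>R (if y = 0 then - sigma_z - sigma_x else - sigma_z + sigma_x)"

text \<open>\<open>chsh_prob a' b' x y\<close> is \<open>P(a',b'|x,y)\<close>.\<close>

definition chsh_prob :: "nat \<Rightarrow> nat \<Rightarrow> nat \<Rightarrow> nat \<Rightarrow> real" where
  "chsh_prob a' b' x y = born_prob singlet (alice_obs x) (bob_obs y) a' b'"


section \<open>The distribution in the triangle network\<close>

definition alice_out :: "nat \<Rightarrow> nat \<Rightarrow> nat" where
  "alice_out x a' = (if a' = 0 then 0 else if x = 0 then 1 else 2)"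

definition bob_out :: "nat \<Rightarrow> nat \<Rightarrow> nat" where
  "bob_out y b' = (if b' = 0 then (if y = 0 then 0 else 1) else 2)"

definition triangle_distribution :: "nat \<Rightarrow> nat \<Rightarrow> nat \<Rightarrow> real" where
  "triangle_distribution a b c =
     (\<Sum>x\<in>{0,1}. \<Sum>y\<in>{0,1}. \<Sum>a'\<in>{0,1}. \<Sum>b'\<in>{0,1}.
        if a = alice_out x a' \<and> b = bob_out y b' \<and> c = x * y
        then 1 / 2 * (1 / 2) * chsh_prob a' b' x y else 0)"

end

theory Submission
  imports Defs
begin

text \<open>In a triangle-local model the inputs can be recovered from the sources at Charlie. Let
  \<open>X\<close> and \<open>Y\<close> be the sets of values of \<open>\<beta>\<close> and \<open>\<alpha>\<close> for which Charlie outputs 1 with positive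
  probability. By independence, \<open>a = 1\<close> excludes \<open>\<beta> \<in> X\<close> and \<open>b = 0\<close> excludes \<open>\<alpha> \<in> Y\<close>, while
  \<open>c = 1\<close> and hence also \<open>(a, b) = (2, 1)\<close> force \<open>\<beta> \<in> X\<close> and \<open>\<alpha> \<in> Y\<close>. Conditionally on \<open>\<gamma>\<close>, the
  indicators of \<open>X\<close> and \<open>Y\<close> therefore act as independent inputs of a local strategy, which satisfies
  a CHSH inequality with the biases \<open>u = P(X)\<close> and \<open>v = P(Y)\<close> as parameters. The marginals of the
  distribution confine \<open>u\<close> and \<open>v\<close> to \<open>uv \<ge> 1/4\<close> and \<open>max u v \<le> 1 - p\<close>, where
  \<open>p = (1 + 1/sqrt 2)/4\<close>, and in that range the inequality is violated.\<close>

section \<open>Two-qubit measurements\<close>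

lemma adjoint_mat_mult: "adjoint_mat (A ** B) = adjoint_mat B ** adjoint_mat A"
  by (simp add: adjoint_mat_def matrix_matrix_mult_def vec_eq_iff mult.commute)

text \<open>Each of two orthogonal projectors with the same range fixes the range of the other, so
  \<open>E ** F = F\<close> and \<open>F ** E = E\<close>; the adjoint of the first equation is
  \<open>F ** E = F\<close>. This makes the description in \<open>eigenprojector\<close> well
  defined.\<close>

lemma eigenprojector_unique:
  fixes E F :: "complex ^ 'n ^ 'n"
  assumes "is_eigenprojector X l E" "is_eigenprojector X l F"
  shows "E = F"
proof -
  have absorb: "E ** F = F"
    if "is_eigenprojector X l E" "is_eigenprojector X l F" for E F :: "complex ^ 'n ^ 'n"
  proof -
    have "(E ** F) *v x = F *v x" for x
    proof -
      have "F *v x \<in> range ((*v) E)"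
        using that by (auto simp: is_eigenprojector_def)
      then obtain z where "F *v x = E *v z" by auto
      then show ?thesis
        using that(1) by (metis is_eigenprojector_def matrix_vector_mul_assoc)
    qed
    then show ?thesis by (simp add: matrix_eq)
  qed
  have "F = adjoint_mat (E ** F)"
    using absorb[OF assms] assms(2) by (simp add: is_eigenprojector_def)
  also have "\<dots> = F ** E"
    using assms by (simp add: adjoint_mat_mult is_eigenprojector_def)
  also have "\<dots> = E"
    using absorb[OF assms(2,1)] .
  finally show ?thesis by simp
qed

text \<open>Since \<open>X ** X = mat 1\<close> and l is a sign, (1 + l X)/2 is idempotent and X
  multiplies its image by l. Projectors can thus be read off the entries of the observable, without
  diagonalising it.\<close>

lemma eigenprojector_involution:
  fixes X :: "complex ^ 'n ^ 'n"
  assumes herm: "adjoint_mat X = X" and inv: "X ** X = mat 1" and l: "l = 1 \<or> l = - 1"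
  shows "eigenprojector X l = (\<chi> i j. ((if i = j then 1 else 0) + l * X $ i $ j) / 2)" (is "_ = ?E")
proof -
  have E: "?E *v v = (1 / 2) *s (v + l *s (X *v v))" for v
  proof -
    have "(\<Sum>j\<in>UNIV. ((if i = j then 1 else 0) + l * X $ i $ j) / 2 * v $ j)
        = (\<Sum>j\<in>UNIV. (1 / 2) * (if i = j then v $ j else 0) + (l / 2) * (X $ i $ j * v $ j))" for i
      by (intro sum.cong) (auto simp: field_simps)
    also have "(\<Sum>j\<in>UNIV. (1 / 2) * (if i = j then v $ j else 0) + (l / 2) * (X $ i $ j * v $ j))
        = (1 / 2) * (\<Sum>j\<in>UNIV. if i = j then v $ j else 0)
        + (l / 2) * (\<Sum>j\<in>UNIV. X $ i $ j * v $ j)" for i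
      by (simp only: sum.distrib sum_distrib_left)
    finally show ?thesis
      by (simp add: vec_eq_iff matrix_vector_mult_def field_simps)
  qed
  have XX: "X *v (X *v v) = v" for v
    by (simp add: matrix_vector_mul_assoc inv)
  have "(?E ** ?E) *v v = ?E *v v" for v
    unfolding matrix_vector_mul_assoc[symmetric] E
    using l by (auto simp: matrix_vector_right_distrib vector_scalar_commute XX vec_eq_iff)
  then have idem: "?E ** ?E = ?E" by (simp add: matrix_eq)
  have "cnj (X $ j $ i) = X $ i $ j" for i j
    using arg_cong[OF herm, of "\<lambda>A. A $ i $ j"] by (simp add: adjoint_mat_def)
  moreover have "cnj l = l" using l by auto
  ultimately have adj: "adjoint_mat ?E = ?E"
    by (simp add: adjoint_mat_def vec_eq_iff)
  have "range ((*v) ?E) = {v. X *v v = l *s v}"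
  proof (intro equalityI subsetI)
    fix x assume "x \<in> range ((*v) ?E)"
    then obtain v where x: "x = (1 / 2) *s (v + l *s (X *v v))" using E by auto
    show "x \<in> {v. X *v v = l *s v}" unfolding x
      using l by (auto simp: matrix_vector_right_distrib vector_scalar_commute XX vec_eq_iff)
  next
    fix x assume "x \<in> {v. X *v v = l *s v}"
    then have "?E *v x = x" unfolding E
      using l by (auto simp: vec_eq_iff)
    then show "x \<in> range ((*v) ?E)" by (rule range_eqI[OF sym])
  qed
  then have "is_eigenprojector X l ?E"
    using adj idem by (simp add: is_eigenprojector_def)
  then show ?thesis
    unfolding eigenprojector_def using eigenprojector_unique by (intro the_equality) auto
qed

section \<open>Born probabilities of the singlet and the values of the distribution\<close>

lemma exhaust_2_zero: "(i :: 2) = 0 \<or> i = 1"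
  using exhaust_2[of i] by auto

lemma UNIV_2_zero: "(UNIV :: 2 set) = {0, 1}"
  using exhaust_2_zero by auto

lemma UNIV_2_prod: "(UNIV :: (2 \<times> 2) set) = {(0,0),(0,1),(1,0),(1,1)}"
  using exhaust_2_zero by auto

text \<open>Only the components 01 and 10 of the singlet are nonzero; they are opposite and have
  square 1/2, which leaves four signed products of entries.\<close>

lemma cinner_singlet:
  "cinner singlet (tensor_mat E F *v singlet)
    = (E $ 0 $ 0 * F $ 1 $ 1 - E $ 0 $ 1 * F $ 1 $ 0 - E $ 1 $ 0 * F $ 0 $ 1 + E $ 1 $ 1 * F $ 0 $ 0) / 2"
proof -
  have s2: "complex_of_real (sqrt 2) * complex_of_real (sqrt 2) = 2"
    by (metis abs_numeral of_real_mult of_real_numeral real_sqrt_mult_self)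
  have S: "singlet $ (0,0) = 0" "singlet $ (1,1) = 0"
    "singlet $ (0,1) = 1 / sqrt 2" "singlet $ (1,0) = - (1 / sqrt 2)"
    by (simp_all add: singlet_def tensor_vec_def ket_def axis_def)
      (simp_all add: scaleR_conv_of_real)
  show ?thesis
    by (simp add: cinner_def matrix_vector_mult_def UNIV_2_prod S tensor_mat_def)
      (simp add: field_simps s2)
qed

lemma alice_obs_entries:
  "alice_obs x $ 0 $ 0 = of_bool (x = 0)" "alice_obs x $ 1 $ 1 = - of_bool (x = 0)"
  "alice_obs x $ 0 $ 1 = of_bool (x \<noteq> 0)" "alice_obs x $ 1 $ 0 = of_bool (x \<noteq> 0)"
  by (simp_all add: alice_obs_def sigma_x_def sigma_z_def)

lemma bob_obs_entries:
  "bob_obs y $ 0 $ 0 = - (1 / sqrt 2)" "bob_obs y $ 1 $ 1 = 1 / sqrt 2"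
  "bob_obs y $ 0 $ 1 = (if y = 0 then - (1 / sqrt 2) else 1 / sqrt 2)"
  "bob_obs y $ 1 $ 0 = (if y = 0 then - (1 / sqrt 2) else 1 / sqrt 2)"
  by (simp_all add: bob_obs_def sigma_x_def sigma_z_def) (simp_all add: scaleR_conv_of_real)

lemma mat2_eqI:
  fixes A B :: "'a ^ 2 ^ 2"
  assumes "A $ 0 $ 0 = B $ 0 $ 0" "A $ 0 $ 1 = B $ 0 $ 1" "A $ 1 $ 0 = B $ 1 $ 0" "A $ 1 $ 1 = B $ 1 $ 1"
  shows "A = B"
proof -
  have "A $ i $ j = B $ i $ j" for i j
    using assms exhaust_2_zero[of i] exhaust_2_zero[of j] by auto
  then show ?thesis by (simp add: vec_eq_iff)
qed

lemma involution_alice: "alice_obs x ** alice_obs x = mat 1"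
  by (intro mat2_eqI) (simp_all add: matrix_matrix_mult_def UNIV_2_zero alice_obs_entries mat_def)

lemma involution_bob: "bob_obs y ** bob_obs y = mat 1"
proof -
  have s2: "complex_of_real (sqrt 2) * complex_of_real (sqrt 2) = 2"
    by (metis abs_numeral of_real_mult of_real_numeral real_sqrt_mult_self)
  show ?thesis
    by (intro mat2_eqI) (simp_all add: matrix_matrix_mult_def UNIV_2_zero bob_obs_entries mat_def s2)
qed

lemma hermitian_alice: "adjoint_mat (alice_obs x) = alice_obs x"
  by (intro mat2_eqI) (simp_all add: adjoint_mat_def alice_obs_entries)

lemma hermitian_bob: "adjoint_mat (bob_obs y) = bob_obs y"
  by (intro mat2_eqI) (simp_all add: adjoint_mat_def bob_obs_entries)

text \<open>The singlet has vanishing local expectations, so from the product of the two projectors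
  only the constant and the correlator survive, and the correlator is (-1)^(x*y) / sqrt 2.
  Restricting to bits matters because the observables treat every nonzero input alike, while the
  exponent does not.\<close>

lemma chsh_prob_eq:
  assumes "x \<in> {0,1}" "y \<in> {0,1}"
  shows "chsh_prob r s x y = (1 + (- 1) ^ (r + s + x * y) / sqrt 2) / 4"
proof -
  have P: "(- 1 :: complex) ^ n = 1 \<or> (- 1 :: complex) ^ n = - 1" for n :: nat
    by (cases "even n") auto
  \<comment> \<open>Writing the signs as embedded reals lets the real part be taken of every
    term.\<close>
  have Pr: "(- 1 :: complex) ^ n = complex_of_real ((- 1) ^ n)" for n :: nat
    by simp
  have s2: "sqrt 2 * (sqrt 2 * z) = 2 * z" for z
    by (simp flip: mult.assoc)
  note E = eigenprojector_involution[OF hermitian_alice involution_alice P]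
    eigenprojector_involution[OF hermitian_bob involution_bob P]
  show ?thesis
    unfolding chsh_prob_def born_prob_def E cinner_singlet
    using assms unfolding Pr
    by (auto simp: alice_obs_entries bob_obs_entries power_add field_simps Re_divide s2
        simp del: of_real_power)
qed

text \<open>Given the inputs, an outcome pair with a' + b' = xy modulo 2 has probability
  \<open>p\<close>, any other pair \<open>q\<close>. The zeros drive the whole argument: c = 1 means
  x = y = 1 and so excludes a = 1 and b = 0, while (a, b) = (2, 1) means x = y = 1 and so excludes c
  = 0.\<close>

lemma triangle_distribution_values:
  fixes p q :: real
  defines "p \<equiv> (1 + 1 / sqrt 2) / 4" and "q \<equiv> 1/2 - p"
  shows "triangle_distribution 0 0 0 = p / 2" "triangle_distribution 0 0 1 = 0"
    "triangle_distribution 0 1 0 = p / 4" "triangle_distribution 0 1 1 = q / 4"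
    "triangle_distribution 0 2 0 = 3 * q / 4" "triangle_distribution 0 2 1 = p / 4"
    "triangle_distribution 1 0 0 = q / 4" "triangle_distribution 1 0 1 = 0"
    "triangle_distribution 1 1 0 = q / 4" "triangle_distribution 1 1 1 = 0"
    "triangle_distribution 1 2 0 = p / 2" "triangle_distribution 1 2 1 = 0"
    "triangle_distribution 2 0 0 = q / 4" "triangle_distribution 2 0 1 = 0"
    "triangle_distribution 2 1 0 = 0" "triangle_distribution 2 1 1 = p / 4"
    "triangle_distribution 2 2 0 = p / 4" "triangle_distribution 2 2 1 = q / 4"
  by (simp_all add: triangle_distribution_def chsh_prob_eq alice_out_def bob_out_def p_def q_def
      field_simps)

section \<open>The CHSH inequality with biased inputs\<close>

text \<open>The variables are probabilities conditional on \<open>\<gamma>\<close>: \<open>e1\<close> of \<open>a = 2, \<beta> \<in> X\<close>; \<open>e0\<close>, \<open>h\<close>, \<open>z\<close> of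
  \<open>a = 1, 2, 0\<close> together with \<open>\<beta> \<notin> X\<close>; \<open>f1\<close> of \<open>b = 1, \<alpha> \<in> Y\<close>; \<open>f0\<close>, \<open>g\<close>, \<open>k\<close> of \<open>b = 0, 1, 2\<close>
  together with \<open>\<alpha> \<notin> Y\<close>. Multiplying the CHSH inequality out by the biases avoids divisions.\<close>

lemma chsh_pointwise:
  fixes e0 e1 h z f0 f1 g k u v :: real
  assumes nonneg: "0 \<le> e0" "0 \<le> e1" "0 \<le> h" "0 \<le> z" "0 \<le> f0" "0 \<le> f1" "0 \<le> g" "0 \<le> k"
    and le: "e1 \<le> u" "f1 \<le> v"
    and zero: "e1 * g = 0" "h * f1 = 0"
  shows "(e1 * f1) * ((e0 + h + z) * (f0 + g + k))
    \<le> (e1 * f0) * (v * (e0 + h + z)) + (e0 * f1) * (u * (f0 + g + k)) + (z * k) * (u * v)"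
proof (cases "e1 * f1 = 0")
  case True
  have "0 \<le> u" "0 \<le> v" using nonneg le by linarith+
  then show ?thesis unfolding True using nonneg by simp
next
  case False
  then have gh: "g = 0" "h = 0" using zero by auto
  \<comment> \<open>With g = h = 0, Alice outputs 1 or 0 outside X and Bob outputs 0 or 2 outside Y.
    The expansion is sorted into three cases: Bob outputs 0; Alice outputs 1 and Bob 2; Alice
    outputs 0 and Bob 2.\<close>
  have "(e1 * f1) * ((e0 + z) * (f0 + k))
      = (e1 * f0) * (f1 * (e0 + z)) + (e0 * f1) * (e1 * k) + (z * k) * (e1 * f1)"
    by (simp add: algebra_simps)
  also have "\<dots> \<le> (e1 * f0) * (v * (e0 + z)) + (e0 * f1) * (u * (f0 + k)) + (z * k) * (u * v)"
    using nonneg le by (intro add_mono mult_left_mono mult_right_mono mult_mono) auto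
  finally show ?thesis by (simp add: gh)
qed

lemma input_bias_gap_ordered:
  fixes u v p :: real
  assumes "426 / 1000 \<le> p" "p \<le> 1/2" "0 \<le> u" "u \<le> v" "1/2 \<le> v" "v \<le> 1 - p"
  shows "(1/2 - p) * v * (1 - u) + (1/2 - p) * u * (1 - v) + u * v * (2 * (1 - v) - 2 * p)
    < p * (1 - u) * (1 - v)"
proof -
  \<comment> \<open>The difference of the two sides is affine and decreasing in u, so the case u = v is the worst;
    there it is a cubic in v with its minimum near v = 0.515.\<close>
  have "0 \<le> (v - 515/1000)\<^sup>2 * (v + 743/1000)" using assms by simp
  \<comment> \<open>The factor \<open>v + 743/1000\<close> comes from matching the coefficient of
    the square of v; the remainder is linear with positive coefficients.\<close>
  moreover have "426/1000 * (1 + v\<^sup>2) - v - v\<^sup>2 + 2 * v^3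
      = 2 * ((v - 515/1000)\<^sup>2 * (v + 743/1000)) + 13/100000 * v + 3187565/100000000"
    by (simp add: power2_eq_square power3_eq_cube field_simps)
  ultimately have A: "0 < 426/1000 * (1 + v\<^sup>2) - v - v\<^sup>2 + 2 * v^3"
    using assms by linarith
  have "426/1000 * (1 + v\<^sup>2) \<le> p * (1 + v\<^sup>2)" using assms by (intro mult_right_mono) auto
  then have B: "0 < p * (1 + v\<^sup>2) - v - v\<^sup>2 + 2 * v^3" using A by linarith
  \<comment> \<open>The second factor is minus the slope in u. Only its middle term can be negative;
    \<open>v \<le> 1 - p\<close> bounds that term below by -2 (1/2 - p)^2 and gives
    \<open>p * (1 - v) \<ge> p * p\<close>, which outweighs it for these p.\<close>
  have "0 \<le> (v - u) * (p * (1 - v) + (1/2 - p) * (1 - 2 * v) + 2 * v * (1 - v - p))"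
  proof (rule mult_nonneg_nonneg)
    have "(1/2 - p) * (2 * v - 1) \<le> (1/2 - p) * (1 - 2 * p)" "p * p \<le> p * (1 - v)"
      using assms by (intro mult_left_mono; simp)+
    moreover have "0 \<le> v * (1 - v - p)" using assms by simp
    moreover have "2 * (1/2 - p) * (1/2 - p) \<le> p * p"
    proof -
      have "(1/2 - p) * (1/2 - p) \<le> (74/1000) * (74/1000)" using assms by (intro mult_mono) auto
      moreover have "(426/1000) * (426/1000) \<le> p * p" using assms by (intro mult_mono) auto
      ultimately show ?thesis by linarith
    qed
    ultimately show "0 \<le> p * (1 - v) + (1/2 - p) * (1 - 2 * v) + 2 * v * (1 - v - p)"
      by (simp add: algebra_simps)
  qed (use assms in auto)
  moreover have "p * (1 - u) * (1 - v)
      - ((1/2 - p) * v * (1 - u) + (1/2 - p) * u * (1 - v) + u * v * (2 * (1 - v) - 2 * p))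
    = (p * (1 + v\<^sup>2) - v - v\<^sup>2 + 2 * v^3)
      + (v - u) * (p * (1 - v) + (1/2 - p) * (1 - 2 * v) + 2 * v * (1 - v - p))"
    by (simp add: power2_eq_square power3_eq_cube field_simps)
  ultimately show ?thesis using B by linarith
qed

text \<open>This is the strict reverse of the integrated CHSH inequality, and so the source of the
  contradiction. The product bound forces the larger bias to be at least 1/2, the minimum belongs to
  the larger bias, and symmetry reduces to the ordered case.\<close>

lemma input_bias_gap:
  fixes u v p :: real
  assumes "426 / 1000 \<le> p" "p \<le> 1/2" "0 \<le> u" "0 \<le> v" "u \<le> 1 - p" "v \<le> 1 - p" "1/4 \<le> u * v"
  shows "(1/2 - p) * v * (1 - u) + (1/2 - p) * u * (1 - v)
      + u * v * min (2 * (1 - u) - 2 * p) (2 * (1 - v) - 2 * p)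
    < p * (1 - u) * (1 - v)"
proof -
  have half: "1/2 \<le> max u v"
  proof (rule ccontr)
    assume "\<not> 1/2 \<le> max u v"
    then have "u * v < 1/2 * (1/2)" using assms by (intro mult_strict_mono') auto
    then show False using assms by simp
  qed
  show ?thesis
  proof (cases "u \<le> v")
    case True
    then have "min (2 * (1 - u) - 2 * p) (2 * (1 - v) - 2 * p) = 2 * (1 - v) - 2 * p" by simp
    then show ?thesis using input_bias_gap_ordered[of p u v] half assms True by simp
  next
    case False
    then have "min (2 * (1 - u) - 2 * p) (2 * (1 - v) - 2 * p) = 2 * (1 - u) - 2 * p" by simp
    then show ?thesis using input_bias_gap_ordered[of p v u] half assms False by (simp add: mult_ac)
  qed
qed

section \<open>Response functions\<close>

text \<open>The class is closed under products, complements and integrating out a source, so that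
  integrability on probability spaces comes for free.\<close>

definition response :: "'w measure \<Rightarrow> ('w \<Rightarrow> real) \<Rightarrow> bool" where
  "response M f \<longleftrightarrow> f \<in> borel_measurable M \<and> (\<forall>w\<in>space M. 0 \<le> f w \<and> f w \<le> 1)"

lemma responseD:
  assumes "response M f"
  shows "f \<in> borel_measurable M" "\<And>w. w \<in> space M \<Longrightarrow> 0 \<le> f w" "\<And>w. w \<in> space M \<Longrightarrow> f w \<le> 1"
  using assms by (auto simp: response_def)

lemma response_mult: "response M f \<Longrightarrow> response M g \<Longrightarrow> response M (\<lambda>w. f w * g w)"
  by (auto simp: response_def intro: mult_le_one)

lemma response_compl: "response M f \<Longrightarrow> response M (\<lambda>w. 1 - f w)"
  by (auto simp: response_def)

lemma response_one: "response M (\<lambda>w. 1)"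
  by (auto simp: response_def)

lemma response_compose:
  assumes "response N f" "g \<in> measurable M N"
  shows "response M (\<lambda>w. f (g w))"
  using assms by (auto simp: response_def dest: measurable_space)

lemma (in prob_space) response_integrable: "response M f \<Longrightarrow> integrable M f"
  by (auto simp: response_def intro!: integrable_const_bound[of _ 1])

lemma (in prob_space) response_expectation:
  assumes "response M f"
  shows "0 \<le> expectation f" "expectation f \<le> 1"
proof -
  show "0 \<le> expectation f"
    using assms by (intro integral_nonneg_AE AE_I2) (auto simp: response_def)
  have "expectation f \<le> expectation (\<lambda>_. 1)"
    using assms by (intro integral_mono response_integrable response_one) (auto simp: response_def)
  then show "expectation f \<le> 1" by (simp add: prob_space)
qed

lemma (in prob_space) response_integral_section:
  assumes "response (N \<Otimes>\<^sub>M M) f"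
  shows "response N (\<lambda>x. \<integral>y. f (x, y) \<partial>M)"
proof -
  have [measurable]: "f \<in> borel_measurable (N \<Otimes>\<^sub>M M)" using assms by (simp add: response_def)
  have "response M (\<lambda>y. f (x, y))" if "x \<in> space N" for x
    using response_compose[OF assms, of "Pair x" M] that by simp
  then show ?thesis
    unfolding response_def[of N] using response_expectation by simp
qed

lemma response_cond_distribution:
  assumes "cond_distribution M S Q" "finite S" "s \<in> S"
  shows "response M (Q s)"
  unfolding response_def
proof (intro conjI ballI)
  fix w assume w: "w \<in> space M"
  then have nonneg: "\<forall>t\<in>S. 0 \<le> Q t w" and "(\<Sum>t\<in>S. Q t w) = 1"
    using assms(1) by (auto simp: cond_distribution_def)
  then show "0 \<le> Q s w" "Q s w \<le> 1"
    using assms member_le_sum[of s S "\<lambda>t. Q t w"] by auto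
qed (use assms in \<open>auto simp: cond_distribution_def\<close>)

lemma response_positive: "response M f \<Longrightarrow> response M (\<lambda>x. of_bool (f x > 0))"
  by (auto simp: response_def)

lemma (in prob_space) response_expectation_zero_iff:
  "response M f \<Longrightarrow> expectation f = 0 \<longleftrightarrow> (AE x in M. f x = 0)"
  by (intro integral_nonneg_eq_0_iff_AE response_integrable) (auto simp: response_def)

text \<open>The law of total probability over the values of one output; it yields all marginals of
  the model.\<close>

lemma (in prob_space) expectation_split:
  assumes "finite S" "response M f" "\<And>s. s \<in> S \<Longrightarrow> response M (g s)"
    and "\<And>w. w \<in> space M \<Longrightarrow> (\<Sum>s\<in>S. g s w) = 1"
  shows "expectation f = (\<Sum>s\<in>S. expectation (\<lambda>w. f w * g s w))"
proof -
  have "expectation f = expectation (\<lambda>w. \<Sum>s\<in>S. f w * g s w)"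
    using assms(4) by (intro Bochner_Integration.integral_cong) (simp_all flip: sum_distrib_left)
  also have "\<dots> = (\<Sum>s\<in>S. expectation (\<lambda>w. f w * g s w))"
    using assms by (intro Bochner_Integration.integral_sum response_integrable response_mult)
  finally show ?thesis .
qed

section \<open>Three independent sources\<close>

locale three_sources =
  A: prob_space \<mu> + B: prob_space \<eta> + C: prob_space \<nu>
  for \<mu> :: "'x measure" and \<eta> :: "'y measure" and \<nu> :: "'z measure"
begin

definition \<Omega> :: "('x \<times> 'y \<times> 'z) measure" where
  "\<Omega> = \<mu> \<Otimes>\<^sub>M (\<eta> \<Otimes>\<^sub>M \<nu>)"

sublocale BC: pair_prob_space \<eta> \<nu> ..
sublocale ABC: pair_prob_space \<mu> "\<eta> \<Otimes>\<^sub>M \<nu>" ..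
sublocale Omega: prob_space \<Omega>
  unfolding \<Omega>_def by (rule ABC.prob_space_axioms)

lemma sets_Omega [measurable_cong]: "sets \<Omega> = sets (\<mu> \<Otimes>\<^sub>M (\<eta> \<Otimes>\<^sub>M \<nu>))"
  by (simp add: \<Omega>_def)

lemma space_Omega: "space \<Omega> = space \<mu> \<times> (space \<eta> \<times> space \<nu>)"
  by (simp add: \<Omega>_def space_pair_measure)

section \<open>Fubini's theorem for the three sources; the suffix tells which source stays
  outermost\<close>

lemma integral_Omega_A:
  assumes "response \<Omega> f"
  shows "(\<integral>\<omega>. f \<omega> \<partial>\<Omega>) = (\<integral>\<alpha>. \<integral>\<beta>. \<integral>\<gamma>. f (\<alpha>, \<beta>, \<gamma>) \<partial>\<nu> \<partial>\<eta> \<partial>\<mu>)"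
proof -
  have "(\<integral>\<omega>. f \<omega> \<partial>\<Omega>) = (\<integral>\<alpha>. \<integral>p. f (\<alpha>, p) \<partial>(\<eta> \<Otimes>\<^sub>M \<nu>) \<partial>\<mu>)"
    using Omega.response_integrable[OF assms] unfolding \<Omega>_def
    by (intro ABC.integral_fst'[symmetric])
  also have "\<dots> = (\<integral>\<alpha>. \<integral>\<beta>. \<integral>\<gamma>. f (\<alpha>, \<beta>, \<gamma>) \<partial>\<nu> \<partial>\<eta> \<partial>\<mu>)"
  proof (intro Bochner_Integration.integral_cong refl)
    fix \<alpha> assume "\<alpha> \<in> space \<mu>"
    then have "response (\<eta> \<Otimes>\<^sub>M \<nu>) (\<lambda>p. f (\<alpha>, p))"
      using response_compose[OF assms, of "Pair \<alpha>" "\<eta> \<Otimes>\<^sub>M \<nu>"] by (simp add: \<Omega>_def)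
    then show "(\<integral>p. f (\<alpha>, p) \<partial>(\<eta> \<Otimes>\<^sub>M \<nu>)) = (\<integral>\<beta>. \<integral>\<gamma>. f (\<alpha>, \<beta>, \<gamma>) \<partial>\<nu> \<partial>\<eta>)"
      by (intro BC.integral_fst'[symmetric] BC.response_integrable)
  qed
  finally show ?thesis .
qed

lemma integral_Omega_BC:
  assumes "response \<Omega> f"
  shows "(\<integral>\<omega>. f \<omega> \<partial>\<Omega>) = (\<integral>p. \<integral>\<alpha>. f (\<alpha>, p) \<partial>\<mu> \<partial>(\<eta> \<Otimes>\<^sub>M \<nu>))"
  using ABC.integral_snd[of "\<lambda>\<alpha> p. f (\<alpha>, p)"] Omega.response_integrable[OF assms]
  by (simp add: \<Omega>_def)

lemma response_section_A:
  assumes "response \<Omega> f"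
  shows "response (\<eta> \<Otimes>\<^sub>M \<nu>) (\<lambda>p. \<integral>\<alpha>. f (\<alpha>, p) \<partial>\<mu>)"
  using A.response_integral_section[OF response_compose[OF assms,
      of "\<lambda>(p, \<alpha>). (\<alpha>, p)" "(\<eta> \<Otimes>\<^sub>M \<nu>) \<Otimes>\<^sub>M \<mu>"]]
  by simp

lemma integral_Omega_B:
  assumes "response \<Omega> f"
  shows "(\<integral>\<omega>. f \<omega> \<partial>\<Omega>) = (\<integral>\<beta>. \<integral>\<gamma>. \<integral>\<alpha>. f (\<alpha>, \<beta>, \<gamma>) \<partial>\<mu> \<partial>\<nu> \<partial>\<eta>)"
  unfolding integral_Omega_BC[OF assms]
  using BC.integral_fst'[OF BC.response_integrable[OF response_section_A[OF assms]]] by simp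

lemma integral_Omega_C:
  assumes "response \<Omega> f"
  shows "(\<integral>\<omega>. f \<omega> \<partial>\<Omega>) = (\<integral>\<gamma>. \<integral>\<beta>. \<integral>\<alpha>. f (\<alpha>, \<beta>, \<gamma>) \<partial>\<mu> \<partial>\<eta> \<partial>\<nu>)"
  unfolding integral_Omega_BC[OF assms]
  using BC.integral_snd[of "\<lambda>\<beta> \<gamma>. \<integral>\<alpha>. f (\<alpha>, \<beta>, \<gamma>) \<partial>\<mu>"]
    BC.response_integrable[OF response_section_A[OF assms]] by (simp add: case_prod_beta')

lemma response_lift_A:
  assumes "response (\<eta> \<Otimes>\<^sub>M \<nu>) F"
  shows "response \<Omega> (\<lambda>(\<alpha>, \<beta>, \<gamma>). F (\<beta>, \<gamma>))"
  using response_compose[OF assms, of "\<lambda>(\<alpha>, \<beta>, \<gamma>). (\<beta>, \<gamma>)" \<Omega>] by (simp add: case_prod_beta')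

lemma response_lift_B:
  assumes "response (\<nu> \<Otimes>\<^sub>M \<mu>) F"
  shows "response \<Omega> (\<lambda>(\<alpha>, \<beta>, \<gamma>). F (\<gamma>, \<alpha>))"
  using response_compose[OF assms, of "\<lambda>(\<alpha>, \<beta>, \<gamma>). (\<gamma>, \<alpha>)" \<Omega>] by (simp add: case_prod_beta')

lemma response_lift_C:
  assumes "response (\<mu> \<Otimes>\<^sub>M \<eta>) F"
  shows "response \<Omega> (\<lambda>(\<alpha>, \<beta>, \<gamma>). F (\<alpha>, \<beta>))"
  using response_compose[OF assms, of "\<lambda>(\<alpha>, \<beta>, \<gamma>). (\<alpha>, \<beta>)" \<Omega>] by (simp add: case_prod_beta')

text \<open>Alice and Bob share only \<gamma>; once it is fixed, their responses depend on the
  independent \<beta> and \<alpha> and the integral factorises. The two variants below treat the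
  other pairs of parties.\<close>

lemma integral_split_C:
  assumes "response (\<eta> \<Otimes>\<^sub>M \<nu>) F" "response (\<nu> \<Otimes>\<^sub>M \<mu>) G"
  shows "(\<integral>(\<alpha>, \<beta>, \<gamma>). F (\<beta>, \<gamma>) * G (\<gamma>, \<alpha>) \<partial>\<Omega>)
    = (\<integral>\<gamma>. (\<integral>\<beta>. F (\<beta>, \<gamma>) \<partial>\<eta>) * (\<integral>\<alpha>. G (\<gamma>, \<alpha>) \<partial>\<mu>) \<partial>\<nu>)"
  using integral_Omega_C[OF response_mult[OF response_lift_A[OF assms(1)] response_lift_B[OF assms(2)]]]
  by (simp add: case_prod_beta')

lemma integral_split_B:
  assumes "response (\<eta> \<Otimes>\<^sub>M \<nu>) F" "response (\<mu> \<Otimes>\<^sub>M \<eta>) H"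
  shows "(\<integral>(\<alpha>, \<beta>, \<gamma>). F (\<beta>, \<gamma>) * H (\<alpha>, \<beta>) \<partial>\<Omega>)
    = (\<integral>\<beta>. (\<integral>\<gamma>. F (\<beta>, \<gamma>) \<partial>\<nu>) * (\<integral>\<alpha>. H (\<alpha>, \<beta>) \<partial>\<mu>) \<partial>\<eta>)"
  using integral_Omega_B[OF response_mult[OF response_lift_A[OF assms(1)] response_lift_C[OF assms(2)]]]
  by (simp add: case_prod_beta')

lemma integral_split_A:
  assumes "response (\<nu> \<Otimes>\<^sub>M \<mu>) G" "response (\<mu> \<Otimes>\<^sub>M \<eta>) H"
  shows "(\<integral>(\<alpha>, \<beta>, \<gamma>). G (\<gamma>, \<alpha>) * H (\<alpha>, \<beta>) \<partial>\<Omega>)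
    = (\<integral>\<alpha>. (\<integral>\<gamma>. G (\<gamma>, \<alpha>) \<partial>\<nu>) * (\<integral>\<beta>. H (\<alpha>, \<beta>) \<partial>\<eta>) \<partial>\<mu>)"
  using integral_Omega_A[OF response_mult[OF response_lift_B[OF assms(1)] response_lift_C[OF assms(2)]]]
  by (simp add: case_prod_beta')

lemma response_section_B:
  assumes "response (\<eta> \<Otimes>\<^sub>M \<nu>) F"
  shows "response \<nu> (\<lambda>\<gamma>. \<integral>\<beta>. F (\<beta>, \<gamma>) \<partial>\<eta>)"
  using B.response_integral_section[OF response_compose[OF assms, of "\<lambda>(\<gamma>, \<beta>). (\<beta>, \<gamma>)" "\<nu> \<Otimes>\<^sub>M \<eta>"]]
  by simp

section \<open>Recovering the inputs from the support of Charlie's response\<close>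

lemma response_marginal_B:
  assumes "response (\<mu> \<Otimes>\<^sub>M \<eta>) H"
  shows "response \<eta> (\<lambda>\<beta>. \<integral>\<alpha>. H (\<alpha>, \<beta>) \<partial>\<mu>)"
  using A.response_integral_section[OF response_compose[OF assms, of "\<lambda>(\<beta>, \<alpha>). (\<alpha>, \<beta>)" "\<eta> \<Otimes>\<^sub>M \<mu>"]]
  by simp

text \<open>Take \<phi> to be the indicator of the \<beta> at which H has positive mean over
  \<alpha>. Off this set H vanishes almost surely. As F and H share only \<beta>, the zero integral
  says that the product of their means given \<beta> vanishes almost everywhere, so F vanishes
  almost surely on the set.\<close>

lemma support_B:
  assumes H: "response (\<mu> \<Otimes>\<^sub>M \<eta>) H" and F: "response (\<eta> \<Otimes>\<^sub>M \<nu>) F"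
    and zero: "(\<integral>(\<alpha>, \<beta>, \<gamma>). F (\<beta>, \<gamma>) * H (\<alpha>, \<beta>) \<partial>\<Omega>) = 0"
  obtains \<phi> where "response \<eta> \<phi>" "\<And>\<beta>. \<phi> \<beta> \<in> {0, 1}"
    "AE (\<alpha>, \<beta>, \<gamma>) in \<Omega>. (1 - \<phi> \<beta>) * H (\<alpha>, \<beta>) = 0"
    "AE (\<alpha>, \<beta>, \<gamma>) in \<Omega>. F (\<beta>, \<gamma>) * \<phi> \<beta> = 0"
proof -
  define w where "w \<beta> = (\<integral>\<alpha>. H (\<alpha>, \<beta>) \<partial>\<mu>)" for \<beta>
  define \<phi> :: "'y \<Rightarrow> real" where "\<phi> \<beta> = of_bool (w \<beta> > 0)" for \<beta>
  have w: "response \<eta> w" unfolding w_def by (rule response_marginal_B[OF H])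
  have \<phi>: "response \<eta> \<phi>" unfolding \<phi>_def by (rule response_positive[OF w])
  have F1: "response (\<eta> \<Otimes>\<^sub>M \<nu>) (\<lambda>p. 1 - \<phi> (fst p))"
    by (intro response_compl response_compose[OF \<phi>]) simp
  have H1: "response (\<mu> \<Otimes>\<^sub>M \<eta>) (\<lambda>p. \<phi> (snd p))"
    by (intro response_compose[OF \<phi>]) simp
  have "(1 - \<phi> \<beta>) * w \<beta> = 0" if "\<beta> \<in> space \<eta>" for \<beta>
    using responseD(2)[OF w that] by (auto simp: \<phi>_def)
  then have "(\<integral>\<beta>. (1 - \<phi> \<beta>) * w \<beta> \<partial>\<eta>) = 0"
    using Bochner_Integration.integral_cong[of \<eta> \<eta> "\<lambda>\<beta>. (1 - \<phi> \<beta>) * w \<beta>" "\<lambda>_. 0"] by simp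
  then have "(\<integral>(\<alpha>, \<beta>, \<gamma>). (1 - \<phi> \<beta>) * H (\<alpha>, \<beta>) \<partial>\<Omega>) = 0"
    using integral_split_B[OF F1 H] by (simp add: w_def C.prob_space)
  moreover have "response \<Omega> (\<lambda>(\<alpha>, \<beta>, \<gamma>). (1 - \<phi> \<beta>) * H (\<alpha>, \<beta>))"
    using response_mult[OF response_lift_A[OF F1] response_lift_C[OF H]] by (simp add: case_prod_beta')
  ultimately have 1: "AE (\<alpha>, \<beta>, \<gamma>) in \<Omega>. (1 - \<phi> \<beta>) * H (\<alpha>, \<beta>) = 0"
    using Omega.response_expectation_zero_iff by (simp add: case_prod_beta')
  define e where "e \<beta> = (\<integral>\<gamma>. F (\<beta>, \<gamma>) \<partial>\<nu>)" for \<beta>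
  have e: "response \<eta> e" unfolding e_def by (rule C.response_integral_section[OF F])
  have "(\<integral>\<beta>. e \<beta> * w \<beta> \<partial>\<eta>) = 0"
    using zero unfolding integral_split_B[OF F H] e_def w_def .
  then have "AE \<beta> in \<eta>. e \<beta> * w \<beta> = 0"
    using B.response_expectation_zero_iff[OF response_mult[OF e w]] by simp
  then have "AE \<beta> in \<eta>. e \<beta> * \<phi> \<beta> = 0"
    by eventually_elim (auto simp: \<phi>_def)
  then have "(\<integral>\<beta>. e \<beta> * \<phi> \<beta> \<partial>\<eta>) = 0"
    using B.response_expectation_zero_iff[OF response_mult[OF e \<phi>]] by simp
  then have "(\<integral>(\<alpha>, \<beta>, \<gamma>). F (\<beta>, \<gamma>) * \<phi> \<beta> \<partial>\<Omega>) = 0"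
    using integral_split_B[OF F H1] by (simp add: e_def A.prob_space)
  moreover have "response \<Omega> (\<lambda>(\<alpha>, \<beta>, \<gamma>). F (\<beta>, \<gamma>) * \<phi> \<beta>)"
    using response_mult[OF response_lift_A[OF F] response_lift_C[OF H1]] by (simp add: case_prod_beta')
  ultimately have 2: "AE (\<alpha>, \<beta>, \<gamma>) in \<Omega>. F (\<beta>, \<gamma>) * \<phi> \<beta> = 0"
    using Omega.response_expectation_zero_iff by (simp add: case_prod_beta')
  show thesis
    using that[OF \<phi> _ 1 2] by (simp add: \<phi>_def)
qed

text \<open>The mirror image of \<open>support_B\<close>, for Bob and Charlie, who share only
  \<alpha>.\<close>

lemma support_A:
  assumes H: "response (\<mu> \<Otimes>\<^sub>M \<eta>) H" and G: "response (\<nu> \<Otimes>\<^sub>M \<mu>) G"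
    and zero: "(\<integral>(\<alpha>, \<beta>, \<gamma>). G (\<gamma>, \<alpha>) * H (\<alpha>, \<beta>) \<partial>\<Omega>) = 0"
  obtains \<psi> where "response \<mu> \<psi>" "\<And>\<alpha>. \<psi> \<alpha> \<in> {0, 1}"
    "AE (\<alpha>, \<beta>, \<gamma>) in \<Omega>. (1 - \<psi> \<alpha>) * H (\<alpha>, \<beta>) = 0"
    "AE (\<alpha>, \<beta>, \<gamma>) in \<Omega>. G (\<gamma>, \<alpha>) * \<psi> \<alpha> = 0"
proof -
  define w where "w \<alpha> = (\<integral>\<beta>. H (\<alpha>, \<beta>) \<partial>\<eta>)" for \<alpha>
  define \<psi> :: "'x \<Rightarrow> real" where "\<psi> \<alpha> = of_bool (w \<alpha> > 0)" for \<alpha>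
  have w: "response \<mu> w" unfolding w_def by (rule B.response_integral_section[OF H])
  have \<psi>: "response \<mu> \<psi>" unfolding \<psi>_def by (rule response_positive[OF w])
  have G1: "response (\<nu> \<Otimes>\<^sub>M \<mu>) (\<lambda>p. 1 - \<psi> (snd p))"
    by (intro response_compl response_compose[OF \<psi>]) simp
  have H1: "response (\<mu> \<Otimes>\<^sub>M \<eta>) (\<lambda>p. \<psi> (fst p))"
    by (intro response_compose[OF \<psi>]) simp
  have "(1 - \<psi> \<alpha>) * w \<alpha> = 0" if "\<alpha> \<in> space \<mu>" for \<alpha>
    using responseD(2)[OF w that] by (auto simp: \<psi>_def)
  then have "(\<integral>\<alpha>. (1 - \<psi> \<alpha>) * w \<alpha> \<partial>\<mu>) = 0"
    using Bochner_Integration.integral_cong[of \<mu> \<mu> "\<lambda>\<alpha>. (1 - \<psi> \<alpha>) * w \<alpha>" "\<lambda>_. 0"] by simp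
  then have "(\<integral>(\<alpha>, \<beta>, \<gamma>). (1 - \<psi> \<alpha>) * H (\<alpha>, \<beta>) \<partial>\<Omega>) = 0"
    using integral_split_A[OF G1 H] by (simp add: w_def C.prob_space)
  moreover have "response \<Omega> (\<lambda>(\<alpha>, \<beta>, \<gamma>). (1 - \<psi> \<alpha>) * H (\<alpha>, \<beta>))"
    using response_mult[OF response_lift_B[OF G1] response_lift_C[OF H]] by (simp add: case_prod_beta')
  ultimately have 1: "AE (\<alpha>, \<beta>, \<gamma>) in \<Omega>. (1 - \<psi> \<alpha>) * H (\<alpha>, \<beta>) = 0"
    using Omega.response_expectation_zero_iff by (simp add: case_prod_beta')
  define e where "e \<alpha> = (\<integral>\<gamma>. G (\<gamma>, \<alpha>) \<partial>\<nu>)" for \<alpha>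
  have e: "response \<mu> e" unfolding e_def
    using C.response_integral_section[OF response_compose[OF G, of "\<lambda>(\<alpha>, \<gamma>). (\<gamma>, \<alpha>)" "\<mu> \<Otimes>\<^sub>M \<nu>"]]
    by simp
  have "(\<integral>\<alpha>. e \<alpha> * w \<alpha> \<partial>\<mu>) = 0"
    using zero unfolding integral_split_A[OF G H] e_def w_def .
  then have "AE \<alpha> in \<mu>. e \<alpha> * w \<alpha> = 0"
    using A.response_expectation_zero_iff[OF response_mult[OF e w]] by simp
  then have "AE \<alpha> in \<mu>. e \<alpha> * \<psi> \<alpha> = 0"
    by eventually_elim (auto simp: \<psi>_def)
  then have "(\<integral>\<alpha>. e \<alpha> * \<psi> \<alpha> \<partial>\<mu>) = 0"
    using A.response_expectation_zero_iff[OF response_mult[OF e \<psi>]] by simp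
  then have "(\<integral>(\<alpha>, \<beta>, \<gamma>). G (\<gamma>, \<alpha>) * \<psi> \<alpha> \<partial>\<Omega>) = 0"
    using integral_split_A[OF G H1] by (simp add: e_def B.prob_space)
  moreover have "response \<Omega> (\<lambda>(\<alpha>, \<beta>, \<gamma>). G (\<gamma>, \<alpha>) * \<psi> \<alpha>)"
    using response_mult[OF response_lift_B[OF G] response_lift_C[OF H1]] by (simp add: case_prod_beta')
  ultimately have 2: "AE (\<alpha>, \<beta>, \<gamma>) in \<Omega>. G (\<gamma>, \<alpha>) * \<psi> \<alpha> = 0"
    using Omega.response_expectation_zero_iff by (simp add: case_prod_beta')
  show thesis
    using that[OF \<psi> _ 1 2] by (simp add: \<psi>_def)
qed

section \<open>The contradiction from a triangle-local model\<close>

lemma no_triangle_model: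
  assumes PA: "cond_distribution (\<eta> \<Otimes>\<^sub>M \<nu>) {0, 1, 2} PA"
    and PB: "cond_distribution (\<nu> \<Otimes>\<^sub>M \<mu>) {0, 1, 2} PB"
    and PC: "cond_distribution (\<mu> \<Otimes>\<^sub>M \<eta>) {0, 1} PC"
    and model: "\<And>a b c. a \<in> {0, 1, 2} \<Longrightarrow> b \<in> {0, 1, 2} \<Longrightarrow> c \<in> {0, 1} \<Longrightarrow>
      triangle_distribution a b c
        = (\<integral>(\<alpha>, \<beta>, \<gamma>). PA a (\<beta>, \<gamma>) * PB b (\<gamma>, \<alpha>) * PC c (\<alpha>, \<beta>) \<partial>(\<mu> \<Otimes>\<^sub>M \<eta> \<Otimes>\<^sub>M \<nu>))"
  shows False
proof -
  define p q :: real where "p = (1 + 1 / sqrt 2) / 4" and "q = 1/2 - p"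
  note P = triangle_distribution_values[folded p_def, folded q_def, unfolded One_nat_def]
  note rPA = response_cond_distribution[OF PA]
  note rPB = response_cond_distribution[OF PB]
  note rPC = response_cond_distribution[OF PC]
  \<comment> \<open>From here \<open>A\<close>, \<open>B\<close>, \<open>C\<close> are the responses
    of Alice, Bob and Charlie lifted to the common sample space; as name qualifiers the same letters
    refer to the sources \<alpha>, \<beta>, \<gamma>.\<close>
  define A where "A a = (\<lambda>(\<alpha> :: 'x, \<beta>, \<gamma>). PA a (\<beta>, \<gamma>))" for a
  define B where "B b = (\<lambda>(\<alpha>, \<beta> :: 'y, \<gamma>). PB b (\<gamma>, \<alpha>))" for b
  define C where "C c = (\<lambda>(\<alpha>, \<beta>, \<gamma> :: 'z). PC c (\<alpha>, \<beta>))" for c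
  have rA: "response \<Omega> (A a)" if "a \<in> {0, 1, 2}" for a
    unfolding A_def using that by (intro response_lift_A rPA) auto
  have rB: "response \<Omega> (B b)" if "b \<in> {0, 1, 2}" for b
    unfolding B_def using that by (intro response_lift_B rPB) auto
  have rC: "response \<Omega> (C c)" if "c \<in> {0, 1}" for c
    unfolding C_def using that by (intro response_lift_C rPC) auto
  have rABC: "response \<Omega> (A 0)" "response \<Omega> (A 1)" "response \<Omega> (A 2)"
    "response \<Omega> (B 0)" "response \<Omega> (B 1)" "response \<Omega> (B 2)" "response \<Omega> (C 0)" "response \<Omega> (C 1)"
    by (rule rA rB rC, simp)+
  have sumA: "(\<Sum>a\<in>{0, 1, 2}. A a \<omega>) = 1" if "\<omega> \<in> space \<Omega>" for \<omega>
    using PA that by (auto simp: A_def cond_distribution_def space_Omega space_pair_measure)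
  have sumB: "(\<Sum>b\<in>{0, 1, 2}. B b \<omega>) = 1" if "\<omega> \<in> space \<Omega>" for \<omega>
    using PB that by (auto simp: B_def cond_distribution_def space_Omega space_pair_measure)
  have sumC: "(\<Sum>c\<in>{0, 1}. C c \<omega>) = 1" if "\<omega> \<in> space \<Omega>" for \<omega>
    using PC that by (auto simp: C_def cond_distribution_def space_Omega space_pair_measure)
  note split_A = Omega.expectation_split[OF _ _ rA sumA]
  note split_B = Omega.expectation_split[OF _ _ rB sumB]
  note split_C = Omega.expectation_split[OF _ _ rC sumC]
  have ABC: "(\<integral>\<omega>. A a \<omega> * B b \<omega> * C c \<omega> \<partial>\<Omega>) = triangle_distribution a b c"
    if "a \<in> {0, 1, 2}" "b \<in> {0, 1, 2}" "c \<in> {0, 1}" for a b c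
    using model[OF that] by (simp add: A_def B_def C_def \<Omega>_def case_prod_beta')
  have AB: "(\<integral>\<omega>. A a \<omega> * B b \<omega> \<partial>\<Omega>) = (\<Sum>c\<in>{0, 1}. triangle_distribution a b c)"
    if "a \<in> {0, 1, 2}" "b \<in> {0, 1, 2}" for a b
    using split_C[OF _ response_mult[OF rA[OF that(1)] rB[OF that(2)]]] ABC[OF that] by simp
  have AC: "(\<integral>\<omega>. A a \<omega> * C c \<omega> \<partial>\<Omega>) = (\<Sum>b\<in>{0, 1, 2}. triangle_distribution a b c)"
    if "a \<in> {0, 1, 2}" "c \<in> {0, 1}" for a c
    using split_B[OF _ response_mult[OF rA[OF that(1)] rC[OF that(2)]]] ABC[OF that(1) _ that(2)]
    by (simp add: mult.assoc mult.commute[of "C c _"])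
  have BC: "(\<integral>\<omega>. B b \<omega> * C c \<omega> \<partial>\<Omega>) = (\<Sum>a\<in>{0, 1, 2}. triangle_distribution a b c)"
    if "b \<in> {0, 1, 2}" "c \<in> {0, 1}" for b c
    using split_A[OF _ response_mult[OF rB[OF that(1)] rC[OF that(2)]]] ABC[OF _ that]
    by (simp add: mult.assoc mult.commute[of _ "A _ _"] mult.left_commute[of _ "A _ _"])
  have pq: "p + q = 1/2" by (simp add: q_def)
  have A0: "(\<integral>\<omega>. A 0 \<omega> \<partial>\<Omega>) = 1/2"
    using split_C[OF _ rA[of 0]] pq by (simp add: AC P)
  have B2: "(\<integral>\<omega>. B 2 \<omega> \<partial>\<Omega>) = 1/2"
    using split_C[OF _ rB[of 2]] pq by (simp add: BC P)
  have C1: "(\<integral>\<omega>. C 1 \<omega> \<partial>\<Omega>) = 1/4"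
    using split_A[OF _ rC[of 1]] pq by (simp add: AC P mult.commute)

  \<comment> \<open>a = 1 needs x = 0 and c = 1 needs x = 1, so the two never occur together; \<phi>
    takes over the role of x.\<close>
  have "(\<integral>(\<alpha>, \<beta>, \<gamma>). PA 1 (\<beta>, \<gamma>) * PC 1 (\<alpha>, \<beta>) \<partial>\<Omega>) = 0"
    using AC[of 1 1] by (simp add: P A_def C_def case_prod_beta')
  then obtain \<phi> where \<phi>: "response \<eta> \<phi>" "\<And>\<beta>. \<phi> \<beta> \<in> {0, 1}"
    and \<phi>C: "AE (\<alpha>, \<beta>, \<gamma>) in \<Omega>. (1 - \<phi> \<beta>) * PC 1 (\<alpha>, \<beta>) = 0"
    and \<phi>A: "AE (\<alpha>, \<beta>, \<gamma>) in \<Omega>. PA 1 (\<beta>, \<gamma>) * \<phi> \<beta> = 0"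
    using support_B[of "PC 1" "PA 1"] rPA[of 1] rPC[of 1] by auto
  \<comment> \<open>Likewise b = 0 needs y = 0 and c = 1 needs y = 1; \<psi> takes over the role of
    y.\<close>
  have "(\<integral>(\<alpha>, \<beta>, \<gamma>). PB 0 (\<gamma>, \<alpha>) * PC 1 (\<alpha>, \<beta>) \<partial>\<Omega>) = 0"
    using BC[of 0 1] by (simp add: P B_def C_def case_prod_beta')
  then obtain \<psi> where \<psi>: "response \<mu> \<psi>" "\<And>\<alpha>. \<psi> \<alpha> \<in> {0, 1}"
    and \<psi>C: "AE (\<alpha>, \<beta>, \<gamma>) in \<Omega>. (1 - \<psi> \<alpha>) * PC 1 (\<alpha>, \<beta>) = 0"
    and \<psi>B: "AE (\<alpha>, \<beta>, \<gamma>) in \<Omega>. PB 0 (\<gamma>, \<alpha>) * \<psi> \<alpha> = 0"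
    using support_A[of "PC 1" "PB 0"] rPB[of 0] rPC[of 1] by auto
  define X where "X = (\<lambda>(\<alpha> :: 'x, \<beta>, \<gamma> :: 'z). \<phi> \<beta>)"
  define Y where "Y = (\<lambda>(\<alpha>, \<beta> :: 'y, \<gamma> :: 'z). \<psi> \<alpha>)"
  have rX: "response \<Omega> X"
    unfolding X_def using response_compose[OF \<phi>(1), of "\<lambda>(\<alpha>, \<beta>, \<gamma>). \<beta>" \<Omega>] by (simp add: case_prod_beta')
  have rY: "response \<Omega> Y"
    unfolding Y_def using response_compose[OF \<psi>(1), of "\<lambda>(\<alpha>, \<beta>, \<gamma>). \<alpha>" \<Omega>] by (simp add: case_prod_beta')
  note rs = response_mult response_compl rX rY rABC response_one
  note int = Omega.response_integrable
  have X01: "X \<omega> \<in> {0, 1}" and Y01: "Y \<omega> \<in> {0, 1}" for \<omega>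
    using \<phi>(2) \<psi>(2) by (auto simp: X_def Y_def split: prod.splits)
  have XC: "AE \<omega> in \<Omega>. (1 - X \<omega>) * C 1 \<omega> = 0" and XA: "AE \<omega> in \<Omega>. A 1 \<omega> * X \<omega> = 0"
    and YC: "AE \<omega> in \<Omega>. (1 - Y \<omega>) * C 1 \<omega> = 0" and YB: "AE \<omega> in \<Omega>. B 0 \<omega> * Y \<omega> = 0"
    using \<phi>C \<phi>A \<psi>C \<psi>B by (simp_all add: X_def Y_def A_def B_def C_def case_prod_beta')
  \<comment> \<open>The outputs a = 2, b = 1 force c = 1, hence both recovered inputs to be 1.\<close>
  have "(\<integral>\<omega>. A 2 \<omega> * B 1 \<omega> * C 0 \<omega> \<partial>\<Omega>) = 0"
    by (simp add: ABC P)
  then have "AE \<omega> in \<Omega>. A 2 \<omega> * B 1 \<omega> * C 0 \<omega> = 0"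
    by (subst (asm) Omega.response_expectation_zero_iff) (intro rs)+
  then have key: "AE \<omega> in \<Omega>. A 2 \<omega> * B 1 \<omega> * (1 - X \<omega> * Y \<omega>) = 0"
    using XC YC AE_space
  proof eventually_elim
    case (elim \<omega>)
    have "C 0 \<omega> = 1" if "X \<omega> * Y \<omega> = 0" using elim that sumC[of \<omega>] by auto
    then show ?case using elim X01[of \<omega>] Y01[of \<omega>] by auto
  qed
  define u v where "u = (\<integral>\<beta>. \<phi> \<beta> \<partial>\<eta>)" and "v = (\<integral>\<alpha>. \<psi> \<alpha> \<partial>\<mu>)"
  have uv01: "0 \<le> u" "u \<le> 1" "0 \<le> v" "v \<le> 1"
    using B.response_expectation[OF \<phi>(1)] A.response_expectation[OF \<psi>(1)] by (simp_all add: u_def v_def)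
  have r1: "response (\<eta> \<Otimes>\<^sub>M \<nu>) (\<lambda>p. \<phi> (fst p))" "response (\<nu> \<Otimes>\<^sub>M \<mu>) (\<lambda>p. \<psi> (snd p))"
    by (intro response_compose[OF \<phi>(1)] response_compose[OF \<psi>(1)]; simp)+
  have rP: "response (\<eta> \<Otimes>\<^sub>M \<nu>) (PA 0)" "response (\<eta> \<Otimes>\<^sub>M \<nu>) (PA 1)" "response (\<eta> \<Otimes>\<^sub>M \<nu>) (PA 2)"
    "response (\<nu> \<Otimes>\<^sub>M \<mu>) (PB 0)" "response (\<nu> \<Otimes>\<^sub>M \<mu>) (PB 1)" "response (\<nu> \<Otimes>\<^sub>M \<mu>) (PB 2)"
    by (rule rPA rPB, simp, simp)+
  note r2 = response_mult response_compl r1 rP response_one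
  \<comment> \<open>Charlie's output 1 has probability 1/4 and almost surely requires X and Y, which
    are independent because they depend on different sources.\<close>
  have "1/4 \<le> (\<integral>\<omega>. X \<omega> * Y \<omega> \<partial>\<Omega>)"
    unfolding C1[symmetric]
  proof (intro integral_mono_AE int rs)
    show "AE \<omega> in \<Omega>. C 1 \<omega> \<le> X \<omega> * Y \<omega>"
      using XC YC AE_space
    proof eventually_elim
      case (elim \<omega>)
      then show ?case using responseD(3)[OF rABC(8), of \<omega>] X01[of \<omega>] Y01[of \<omega>] by auto
    qed
  qed
  also have "(\<integral>\<omega>. X \<omega> * Y \<omega> \<partial>\<Omega>) = u * v"
    using integral_split_C[OF r1] by (simp add: u_def v_def X_def Y_def case_prod_beta' C.prob_space)
  finally have uv: "1/4 \<le> u * v" .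

  \<comment> \<open>Probabilities conditional on \<gamma> and bounds on their products\<close>
  define sA where "sA F \<gamma> = (\<integral>\<beta>. F (\<beta>, \<gamma>) \<partial>\<eta>)" for F :: "'y \<times> 'z \<Rightarrow> real" and \<gamma>
  define sB where "sB G \<gamma> = (\<integral>\<alpha>. G (\<gamma>, \<alpha>) \<partial>\<mu>)" for G :: "'z \<times> 'x \<Rightarrow> real" and \<gamma>
  have split: "(\<integral>\<gamma>. sA F \<gamma> * sB G \<gamma> \<partial>\<nu>) = (\<integral>(\<alpha>, \<beta>, \<gamma>). F (\<beta>, \<gamma>) * G (\<gamma>, \<alpha>) \<partial>\<Omega>)"
    if "response (\<eta> \<Otimes>\<^sub>M \<nu>) F" "response (\<nu> \<Otimes>\<^sub>M \<mu>) G" for F G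
    using integral_split_C[OF that] by (simp add: sA_def sB_def)
  define e0 e1 h z where "e0 = sA (\<lambda>p. PA 1 p * (1 - \<phi> (fst p)))" and "e1 = sA (\<lambda>p. PA 2 p * \<phi> (fst p))"
    and "h = sA (\<lambda>p. PA 2 p * (1 - \<phi> (fst p)))" and "z = sA (\<lambda>p. PA 0 p * (1 - \<phi> (fst p)))"
  define f0 f1 g k where "f0 = sB (\<lambda>p. PB 0 p * (1 - \<psi> (snd p)))" and "f1 = sB (\<lambda>p. PB 1 p * \<psi> (snd p))"
    and "g = sB (\<lambda>p. PB 1 p * (1 - \<psi> (snd p)))" and "k = sB (\<lambda>p. PB 2 p * (1 - \<psi> (snd p)))"
  note defs = e0_def e1_def h_def z_def f0_def f1_def g_def k_def
  have rsA: "response \<nu> (sA F)" if "response (\<eta> \<Otimes>\<^sub>M \<nu>) F" for F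
    unfolding sA_def by (rule response_section_B[OF that])
  have rsB: "response \<nu> (sB G)" if "response (\<nu> \<Otimes>\<^sub>M \<mu>) G" for G
    unfolding sB_def by (rule A.response_integral_section[OF that])
  have r3: "response \<nu> e0" "response \<nu> e1" "response \<nu> h" "response \<nu> z"
    "response \<nu> f0" "response \<nu> f1" "response \<nu> g" "response \<nu> k"
    unfolding defs by (intro rsA rsB r2)+
  note unlift = A_def B_def X_def Y_def case_prod_beta'
  note rs_zero_iff = Omega.response_expectation_zero_iff
  \<comment> \<open>The two vanishing products required by \<open>chsh_pointwise\<close> follow from
    \<open>key\<close>: each is nonnegative and integrates to the probability of (a, b) = (2, 1)
    with exactly one recovered input equal to 1.\<close>
  have "(\<integral>\<gamma>. e1 \<gamma> * g \<gamma> \<partial>\<nu>) = (\<integral>\<omega>. (A 2 \<omega> * X \<omega>) * (B 1 \<omega> * (1 - Y \<omega>)) \<partial>\<Omega>)"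
    unfolding defs by (subst split) (intro r2, intro r2, simp add: unlift)
  also have "\<dots> = 0"
  proof (subst rs_zero_iff)
    show "AE \<omega> in \<Omega>. (A 2 \<omega> * X \<omega>) * (B 1 \<omega> * (1 - Y \<omega>)) = 0"
      using key by eventually_elim (use X01 Y01 in force)
  qed (intro rs)
  finally have e1g: "AE \<gamma> in \<nu>. e1 \<gamma> * g \<gamma> = 0"
    by (subst (asm) C.response_expectation_zero_iff) (intro response_mult r3)
  have "(\<integral>\<gamma>. h \<gamma> * f1 \<gamma> \<partial>\<nu>) = (\<integral>\<omega>. (A 2 \<omega> * (1 - X \<omega>)) * (B 1 \<omega> * Y \<omega>) \<partial>\<Omega>)"
    unfolding defs by (subst split) (intro r2, intro r2, simp add: unlift)
  also have "\<dots> = 0"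
  proof (subst rs_zero_iff)
    show "AE \<omega> in \<Omega>. (A 2 \<omega> * (1 - X \<omega>)) * (B 1 \<omega> * Y \<omega>) = 0"
      using key by eventually_elim (use X01 Y01 in force)
  qed (intro rs)
  finally have hf1: "AE \<gamma> in \<nu>. h \<gamma> * f1 \<gamma> = 0"
    by (subst (asm) C.response_expectation_zero_iff) (intro response_mult r3)
  have "(\<integral>\<gamma>. e1 \<gamma> * f1 \<gamma> \<partial>\<nu>) = (\<integral>\<omega>. (A 2 \<omega> * X \<omega>) * (B 1 \<omega> * Y \<omega>) \<partial>\<Omega>)"
    unfolding defs by (subst split) (intro r2, intro r2, simp add: unlift)
  also have "\<dots> = (\<integral>\<omega>. A 2 \<omega> * B 1 \<omega> \<partial>\<Omega>)"
  proof (rule integral_cong_AE)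
    show "AE \<omega> in \<Omega>. (A 2 \<omega> * X \<omega>) * (B 1 \<omega> * Y \<omega>) = A 2 \<omega> * B 1 \<omega>"
      using key by eventually_elim (simp add: algebra_simps)
  qed (intro responseD(1) rs)+
  also have "\<dots> = p / 4" by (simp add: AB P)
  finally have e1f1: "(\<integral>\<gamma>. e1 \<gamma> * f1 \<gamma> \<partial>\<nu>) = p / 4" .
  have nonneg: "0 \<le> A 0 \<omega>" "0 \<le> A 1 \<omega>" "0 \<le> A 2 \<omega>" "0 \<le> B 0 \<omega>" "0 \<le> B 1 \<omega>" "0 \<le> B 2 \<omega>"
    if "\<omega> \<in> space \<Omega>" for \<omega>
    using responseD(2)[OF rABC(1) that] responseD(2)[OF rABC(2) that] responseD(2)[OF rABC(3) that]
      responseD(2)[OF rABC(4) that] responseD(2)[OF rABC(5) that] responseD(2)[OF rABC(6) that]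
    by simp_all
  \<comment> \<open>Forgetting the recovered inputs can only enlarge the event and leaves an
    observed probability.\<close>
  have "(\<integral>\<gamma>. e1 \<gamma> * f0 \<gamma> \<partial>\<nu>) = (\<integral>\<omega>. (A 2 \<omega> * X \<omega>) * (B 0 \<omega> * (1 - Y \<omega>)) \<partial>\<Omega>)"
    unfolding defs by (subst split) (intro r2, intro r2, simp add: unlift)
  also have "\<dots> \<le> (\<integral>\<omega>. A 2 \<omega> * B 0 \<omega> \<partial>\<Omega>)"
  proof (intro integral_mono int rs)
    show "(A 2 \<omega> * X \<omega>) * (B 0 \<omega> * (1 - Y \<omega>)) \<le> A 2 \<omega> * B 0 \<omega>" if "\<omega> \<in> space \<Omega>" for \<omega>
      using X01[of \<omega>] Y01[of \<omega>] nonneg[OF that] by auto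
  qed
  also have "\<dots> = q / 4" by (simp add: AB P)
  finally have e1f0: "(\<integral>\<gamma>. e1 \<gamma> * f0 \<gamma> \<partial>\<nu>) \<le> q / 4" .
  have "(\<integral>\<gamma>. e0 \<gamma> * f1 \<gamma> \<partial>\<nu>) = (\<integral>\<omega>. (A 1 \<omega> * (1 - X \<omega>)) * (B 1 \<omega> * Y \<omega>) \<partial>\<Omega>)"
    unfolding defs by (subst split) (intro r2, intro r2, simp add: unlift)
  also have "\<dots> \<le> (\<integral>\<omega>. A 1 \<omega> * B 1 \<omega> \<partial>\<Omega>)"
  proof (intro integral_mono int rs)
    show "(A 1 \<omega> * (1 - X \<omega>)) * (B 1 \<omega> * Y \<omega>) \<le> A 1 \<omega> * B 1 \<omega>" if "\<omega> \<in> space \<Omega>" for \<omega>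
      using X01[of \<omega>] Y01[of \<omega>] nonneg[OF that] by auto
  qed
  also have "\<dots> = q / 4" using AB[of 1 1] by (simp add: P)
  finally have e0f1: "(\<integral>\<gamma>. e0 \<gamma> * f1 \<gamma> \<partial>\<nu>) \<le> q / 4" .

  \<comment> \<open>The obvious bound \<open>P(a = 0, b = 2, c = 0) = 3 * q / 4\<close> is too weak when u or v is near 1 - p;
    subtracting the events known to lie outside X, respectively Y, gives a bound that vanishes there.\<close>
  have zk: "(\<integral>\<gamma>. z \<gamma> * k \<gamma> \<partial>\<nu>) = (\<integral>\<omega>. (A 0 \<omega> * (1 - X \<omega>)) * (B 2 \<omega> * (1 - Y \<omega>)) \<partial>\<Omega>)"
    unfolding defs by (subst split) (intro r2, intro r2, simp add: unlift)
  note diff = Bochner_Integration.integrable_diff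
  have "(\<integral>\<gamma>. z \<gamma> * k \<gamma> \<partial>\<nu>) \<le> (\<integral>\<omega>. (1 - X \<omega>) * B 2 \<omega> - A 1 \<omega> * B 2 \<omega> \<partial>\<Omega>)"
    unfolding zk
  proof (intro integral_mono_AE diff int rs)
    show "AE \<omega> in \<Omega>. (A 0 \<omega> * (1 - X \<omega>)) * (B 2 \<omega> * (1 - Y \<omega>)) \<le> (1 - X \<omega>) * B 2 \<omega> - A 1 \<omega> * B 2 \<omega>"
      using XA AE_space
    proof eventually_elim
      case (elim \<omega>)
      have "(A 0 \<omega> + A 1 \<omega>) * B 2 \<omega> \<le> 1 * B 2 \<omega>"
        using sumA[OF elim(2)] nonneg[OF elim(2)] by (intro mult_right_mono) auto
      moreover have "0 \<le> A 0 \<omega> * B 2 \<omega>" "0 \<le> A 1 \<omega> * B 2 \<omega>" using nonneg[OF elim(2)] by simp_all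
      ultimately show ?case using elim(1) X01[of \<omega>] Y01[of \<omega>] by (auto simp: algebra_simps)
    qed
  qed
  also have "\<dots> = (\<integral>\<omega>. (1 - X \<omega>) * B 2 \<omega> \<partial>\<Omega>) - (\<integral>\<omega>. A 1 \<omega> * B 2 \<omega> \<partial>\<Omega>)"
    by (intro Bochner_Integration.integral_diff int rs)
  \<comment> \<open>X depends on \<beta> alone and Bob's response does not see \<beta>, so the two
    are independent.\<close>
  also have "(\<integral>\<omega>. (1 - X \<omega>) * B 2 \<omega> \<partial>\<Omega>) = (1 - u) * (\<integral>\<omega>. B 2 \<omega> \<partial>\<Omega>)"
  proof -
    have "(\<integral>\<beta>. 1 - \<phi> \<beta> \<partial>\<eta>) = 1 - u"
      using B.response_integrable[OF \<phi>(1)] by (simp add: u_def B.prob_space)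
    then show ?thesis
      using integral_split_C[OF response_compl[OF r1(1)] rP(6)] integral_split_C[OF response_one rP(6)]
      by (simp add: unlift B.prob_space)
  qed
  also have "(\<integral>\<omega>. A 1 \<omega> * B 2 \<omega> \<partial>\<Omega>) = p / 2" using AB[of 1 2] by (simp add: P)
  finally have zk1: "(\<integral>\<gamma>. z \<gamma> * k \<gamma> \<partial>\<nu>) \<le> (1 - u) / 2 - p / 2" by (simp add: B2)
  have "(\<integral>\<gamma>. z \<gamma> * k \<gamma> \<partial>\<nu>) \<le> (\<integral>\<omega>. A 0 \<omega> * (1 - Y \<omega>) - A 0 \<omega> * B 0 \<omega> \<partial>\<Omega>)"
    unfolding zk
  proof (intro integral_mono_AE diff int rs)
    show "AE \<omega> in \<Omega>. (A 0 \<omega> * (1 - X \<omega>)) * (B 2 \<omega> * (1 - Y \<omega>)) \<le> A 0 \<omega> * (1 - Y \<omega>) - A 0 \<omega> * B 0 \<omega>"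
      using YB AE_space
    proof eventually_elim
      case (elim \<omega>)
      have "A 0 \<omega> * (B 0 \<omega> + B 2 \<omega>) \<le> A 0 \<omega> * 1"
        using sumB[OF elim(2)] nonneg[OF elim(2)] by (intro mult_left_mono) auto
      moreover have "0 \<le> A 0 \<omega> * B 2 \<omega>" "0 \<le> A 0 \<omega> * B 0 \<omega>" using nonneg[OF elim(2)] by simp_all
      ultimately show ?case using elim(1) X01[of \<omega>] Y01[of \<omega>] by (auto simp: algebra_simps)
    qed
  qed
  also have "\<dots> = (\<integral>\<omega>. A 0 \<omega> * (1 - Y \<omega>) \<partial>\<Omega>) - (\<integral>\<omega>. A 0 \<omega> * B 0 \<omega> \<partial>\<Omega>)"
    by (intro Bochner_Integration.integral_diff int rs)
  also have "(\<integral>\<omega>. A 0 \<omega> * (1 - Y \<omega>) \<partial>\<Omega>) = (1 - v) * (\<integral>\<omega>. A 0 \<omega> \<partial>\<Omega>)"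
  proof -
    have "(\<integral>\<alpha>. 1 - \<psi> \<alpha> \<partial>\<mu>) = 1 - v"
      using A.response_integrable[OF \<psi>(1)] by (simp add: v_def A.prob_space)
    then show ?thesis
      using integral_split_C[OF rP(1) response_compl[OF r1(2)]] integral_split_C[OF rP(1) response_one]
      by (simp add: unlift A.prob_space)
  qed
  also have "(\<integral>\<omega>. A 0 \<omega> * B 0 \<omega> \<partial>\<Omega>) = p / 2" by (simp add: AB P)
  finally have zk2: "(\<integral>\<gamma>. z \<gamma> * k \<gamma> \<partial>\<nu>) \<le> (1 - v) / 2 - p / 2" by (simp add: A0)
  \<comment> \<open>Against the two upper bounds, nonnegativity also yields
    \<open>u \<le> 1 - p\<close> and \<open>v \<le> 1 - p\<close>.\<close>
  have zk0: "0 \<le> (\<integral>\<gamma>. z \<gamma> * k \<gamma> \<partial>\<nu>)"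
    by (intro C.response_expectation response_mult r3)

  \<comment> \<open>The masses inside and outside X and Y do not vary with \<gamma>, since the
    sources are independent: \<gamma> acts as a hidden variable uncorrelated with the
    inputs.\<close>
  have pointwise: "e1 \<gamma> \<le> u" "f1 \<gamma> \<le> v" "e0 \<gamma> + h \<gamma> + z \<gamma> = 1 - u" "f0 \<gamma> + g \<gamma> + k \<gamma> = 1 - v"
    if \<gamma>: "\<gamma> \<in> space \<nu>" for \<gamma>
  proof -
    have secA: "response \<eta> (\<lambda>\<beta>. PA a (\<beta>, \<gamma>))" if "a \<in> {0, 1, 2}" for a
      using response_compose[OF rPA[OF _ that], of "\<lambda>\<beta>. (\<beta>, \<gamma>)" \<eta>] \<gamma> by simp
    have secB: "response \<mu> (\<lambda>\<alpha>. PB b (\<gamma>, \<alpha>))" if "b \<in> {0, 1, 2}" for b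
      using response_compose[OF rPB[OF _ that], of "\<lambda>\<alpha>. (\<gamma>, \<alpha>)" \<mu>] \<gamma> by simp
    have sec: "response \<eta> (\<lambda>\<beta>. PA 0 (\<beta>, \<gamma>))" "response \<eta> (\<lambda>\<beta>. PA 1 (\<beta>, \<gamma>))"
      "response \<eta> (\<lambda>\<beta>. PA 2 (\<beta>, \<gamma>))" "response \<mu> (\<lambda>\<alpha>. PB 0 (\<gamma>, \<alpha>))"
      "response \<mu> (\<lambda>\<alpha>. PB 1 (\<gamma>, \<alpha>))" "response \<mu> (\<lambda>\<alpha>. PB 2 (\<gamma>, \<alpha>))"
      by (rule secA secB, simp)+
    note secs = response_mult response_compl \<phi>(1) \<psi>(1) sec
    show "e1 \<gamma> \<le> u"
      unfolding e1_def sA_def u_def fst_conv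
    proof (intro integral_mono B.response_integrable secs)
      show "PA 2 (\<beta>, \<gamma>) * \<phi> \<beta> \<le> \<phi> \<beta>" if "\<beta> \<in> space \<eta>" for \<beta>
        using responseD(3)[OF sec(3) that] \<phi>(2)[of \<beta>] by auto
    qed
    show "f1 \<gamma> \<le> v"
      unfolding f1_def sB_def v_def snd_conv
    proof (intro integral_mono A.response_integrable secs)
      show "PB 1 (\<gamma>, \<alpha>) * \<psi> \<alpha> \<le> \<psi> \<alpha>" if "\<alpha> \<in> space \<mu>" for \<alpha>
        using responseD(3)[OF sec(5) that] \<psi>(2)[of \<alpha>] by auto
    qed
    have "(\<Sum>a\<in>{0, 1, 2}. PA a (\<beta>, \<gamma>)) = 1" if "\<beta> \<in> space \<eta>" for \<beta>
      using PA that \<gamma> by (auto simp: cond_distribution_def space_pair_measure)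
    then have "(\<integral>\<beta>. 1 - \<phi> \<beta> \<partial>\<eta>) = (\<Sum>a\<in>{0, 1, 2}. \<integral>\<beta>. (1 - \<phi> \<beta>) * PA a (\<beta>, \<gamma>) \<partial>\<eta>)"
      by (intro B.expectation_split secA secs) auto
    moreover have "(\<integral>\<beta>. 1 - \<phi> \<beta> \<partial>\<eta>) = 1 - u"
      using B.response_integrable[OF \<phi>(1)] by (simp add: u_def B.prob_space)
    ultimately show "e0 \<gamma> + h \<gamma> + z \<gamma> = 1 - u"
      by (simp add: e0_def h_def z_def sA_def mult.commute)
    have "(\<Sum>b\<in>{0, 1, 2}. PB b (\<gamma>, \<alpha>)) = 1" if "\<alpha> \<in> space \<mu>" for \<alpha>
      using PB that \<gamma> by (auto simp: cond_distribution_def space_pair_measure)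
    then have "(\<integral>\<alpha>. 1 - \<psi> \<alpha> \<partial>\<mu>) = (\<Sum>b\<in>{0, 1, 2}. \<integral>\<alpha>. (1 - \<psi> \<alpha>) * PB b (\<gamma>, \<alpha>) \<partial>\<mu>)"
      by (intro A.expectation_split secB secs) auto
    moreover have "(\<integral>\<alpha>. 1 - \<psi> \<alpha> \<partial>\<mu>) = 1 - v"
      using A.response_integrable[OF \<psi>(1)] by (simp add: v_def A.prob_space)
    ultimately show "f0 \<gamma> + g \<gamma> + k \<gamma> = 1 - v"
      by (simp add: f0_def g_def k_def sB_def mult.commute)
  qed
  note int3 = C.response_integrable[OF response_mult]
  note iint = int3[OF r3(2) r3(6)] int3[OF r3(2) r3(5)] int3[OF r3(1) r3(6)] int3[OF r3(4) r3(8)]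
  \<comment> \<open>Because the biases are constants, \<open>chsh_pointwise\<close> can be
    integrated over \<gamma> to give an inequality between the products bounded above.\<close>
  have "(\<integral>\<gamma>. (e1 \<gamma> * f1 \<gamma>) * ((1 - u) * (1 - v)) \<partial>\<nu>)
      \<le> (\<integral>\<gamma>. (e1 \<gamma> * f0 \<gamma>) * (v * (1 - u)) + (e0 \<gamma> * f1 \<gamma>) * (u * (1 - v))
            + (z \<gamma> * k \<gamma>) * (u * v) \<partial>\<nu>)"
  proof (intro integral_mono_AE Bochner_Integration.integrable_add integrable_mult_left iint)
    show "AE \<gamma> in \<nu>. (e1 \<gamma> * f1 \<gamma>) * ((1 - u) * (1 - v))
      \<le> (e1 \<gamma> * f0 \<gamma>) * (v * (1 - u)) + (e0 \<gamma> * f1 \<gamma>) * (u * (1 - v)) + (z \<gamma> * k \<gamma>) * (u * v)"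
      using e1g hf1 AE_space
    proof eventually_elim
      case (elim \<gamma>)
      note pw = pointwise[OF elim(3)]
      show ?case
        unfolding pw(3,4)[symmetric]
        by (intro chsh_pointwise responseD(2)[OF _ elim(3)] r3 pw(1,2) elim(1,2))
    qed
  qed
  also have "\<dots> = (\<integral>\<gamma>. e1 \<gamma> * f0 \<gamma> \<partial>\<nu>) * (v * (1 - u)) + (\<integral>\<gamma>. e0 \<gamma> * f1 \<gamma> \<partial>\<nu>) * (u * (1 - v))
      + (\<integral>\<gamma>. z \<gamma> * k \<gamma> \<partial>\<nu>) * (u * v)"
    by (simp add: iint)
  \<comment> \<open>Both bounds on the last product enter through \<open>min\<close>, since either
    bias may be the larger one.\<close>
  also have "\<dots> \<le> (q / 4) * (v * (1 - u)) + (q / 4) * (u * (1 - v))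
      + min ((1 - u) / 2 - p / 2) ((1 - v) / 2 - p / 2) * (u * v)"
    using e1f0 e0f1 zk1 zk2 uv01 by (intro add_mono mult_right_mono) auto
  finally have "p * (1 - u) * (1 - v) \<le> q * v * (1 - u) + q * u * (1 - v)
      + 4 * (min ((1 - u) / 2 - p / 2) ((1 - v) / 2 - p / 2) * (u * v))"
    by (simp add: e1f1 iint field_simps)
  moreover have "4 * (min ((1 - u) / 2 - p / 2) ((1 - v) / 2 - p / 2) * (u * v))
      = u * v * min (2 * (1 - u) - 2 * p) (2 * (1 - v) - 2 * p)"
    by (simp add: min_def)
  moreover have "426 / 1000 \<le> p" "p \<le> 1/2"
  proof -
    \<comment> \<open>1.42 squared is 2.0164, close enough to 2 to give the threshold 0.426 for
      p.\<close>
    have "sqrt 2 \<le> 1420 / 1000" by (rule real_le_lsqrt) (simp_all add: power2_eq_square)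
    then show "426 / 1000 \<le> p" by (simp add: p_def field_simps)
    show "p \<le> 1/2" by (simp add: p_def field_simps)
  qed
  moreover have "u \<le> 1 - p" using order_trans[OF zk0 zk1] by simp
  moreover have "v \<le> 1 - p" using order_trans[OF zk0 zk2] by simp
  ultimately show False
    using input_bias_gap[of p u v] uv uv01 by (simp add: q_def)
qed

end

theorem mainTheorem5:
  shows "\<not> triangle_local TYPE('x) TYPE('y) TYPE('z) {0, 1, 2} {0, 1, 2} {0, 1} triangle_distribution"
proof
  assume "triangle_local TYPE('x) TYPE('y) TYPE('z) {0, 1, 2} {0, 1, 2} {0, 1} triangle_distribution"
  then obtain \<mu> :: "'x measure" and \<eta> :: "'y measure" and \<nu> :: "'z measure" and PA PB PC where
    prob: "prob_space \<mu>" "prob_space \<eta>" "prob_space \<nu>" and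
    cond: "cond_distribution (\<eta> \<Otimes>\<^sub>M \<nu>) {0, 1, 2} PA" "cond_distribution (\<nu> \<Otimes>\<^sub>M \<mu>) {0, 1, 2} PB"
      "cond_distribution (\<mu> \<Otimes>\<^sub>M \<eta>) {0, 1} PC" and
    model: "\<forall>a\<in>{0, 1, 2}. \<forall>b\<in>{0, 1, 2}. \<forall>c\<in>{0, 1}. triangle_distribution a b c
        = (\<integral>(\<alpha>, \<beta>, \<gamma>). PA a (\<beta>, \<gamma>) * PB b (\<gamma>, \<alpha>) * PC c (\<alpha>, \<beta>) \<partial>(\<mu> \<Otimes>\<^sub>M \<eta> \<Otimes>\<^sub>M \<nu>))"
    unfolding triangle_local_def by blast
  interpret three_sources \<mu> \<eta> \<nu> using prob by (simp add: three_sources_def)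
  show False using no_triangle_model[OF cond] model by blast
qed

end
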